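(* Let $n\ge1$, let $\mu$ be the Lebesgue measure on $[0,1]$ and let $\rho_n(x,y)=\|x-y\|_1=\sum_{i=1}^n|x_i-y_i|$ for $x,y\in[0,1]^n$. Then for all $f\in L_1([0,1]^n,\mu^n)$, $$\|f\|_\Phi\le\|f\|_\Psi .$$
   Context: Let $(z)_+=\max(z,0)$. $\operatorname{Lip}([0,1]^n,\|\cdot\|_1)$ is the set of functions $g:[0,1]^n\to[0,n]$ (note that $n$ is the $\ell_1$-diameter of $[0,1]^n$) with $|g(x)-g(y)|\le\|x-y\|_1$ for all $x,y$. Define $$\|f\|_\Phi=\sup_{g\in\operatorname{Lip}([0,1]^n,\|\cdot\|_1)}\left|\int_{[0,1]^n}f g\,d\mu^n\right|.$$ For $f\in L_1([0,1]^k,\mu^k)$ put $(\pi f)(x_2,\dots,x_k)=\int_0^1 f(x_1,x_2,\dots,x_k)\,d\mu(x_1)$, a function in $L_1([0,1]^{k-1},\mu^{k-1})$. Define recursively $\Psi_0=0$ and, for $k\ge1$, $\Psi_k(f)=\int_{[0,1]^k}(f)_+\,d\mu^k+\Psi_{k-1}(\pi f)$. For $f\in L_1([0,1]^n,\mu^n)$ let $\|f\|_\Psi=\max\{\Psi_n(f),\Psi_n(-f)\}$. *)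

theory Defs
  imports "HOL-Analysis.Analysis"
begin

text \<open>Points of \<open>[0,1]\<^sup>n\<close> are extensional functions on the index set \<open>{..<n}\<close>, so the
  coordinate usually written \<open>x\<^sub>i\<close> (with \<open>1 \<le> i \<le> n\<close>) is \<open>x (i - 1)\<close> here.\<close>

definition unit_cube :: "nat \<Rightarrow> (nat \<Rightarrow> real) set" where
  "unit_cube n = (\<Pi>\<^sub>E i\<in>{..<n}. {0..1})"

definition unit_mu :: "real measure" where
  "unit_mu = lebesgue_on {0..1}"

definition cube_mu :: "nat \<Rightarrow> (nat \<Rightarrow> real) measure" where
  "cube_mu n = (\<Pi>\<^sub>M i\<in>{..<n}. unit_mu)"

definition rho :: "nat \<Rightarrow> (nat \<Rightarrow> real) \<Rightarrow> (nat \<Rightarrow> real) \<Rightarrow> real" where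
  "rho n x y = (\<Sum>i<n. \<bar>x i - y i\<bar>)"

text \<open>Values of \<open>g\<close> outside the cube are unconstrained; they do not enter the integrals below.\<close>

definition Lip :: "nat \<Rightarrow> ((nat \<Rightarrow> real) \<Rightarrow> real) set" where
  "Lip n = {g. g \<in> unit_cube n \<rightarrow> {0..real n} \<and>
     (\<forall>x\<in>unit_cube n. \<forall>y\<in>unit_cube n. \<bar>g x - g y\<bar> \<le> rho n x y)}"

text \<open>For integrable \<open>f\<close> the supremum is over a nonempty set bounded by \<open>n\<close> times the
  \<open>L\<^sub>1\<close> norm of \<open>f\<close>, so the real-valued \<open>Sup\<close> is the genuine supremum.\<close>

definition Phi_norm :: "nat \<Rightarrow> ((nat \<Rightarrow> real) \<Rightarrow> real) \<Rightarrow> real" where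
  "Phi_norm n f = (SUP g\<in>Lip n. \<bar>\<integral>x. f x * g x \<partial>cube_mu n\<bar>)"

text \<open>Integrating out the first coordinate: \<open>case_nat t y\<close> is the point
  \<open>(t, y 0, y 1, \<dots>)\<close>, which lies in \<open>[0,1]\<^sup>k\<close> for \<open>t \<in> [0,1]\<close> and
  \<open>y \<in> [0,1]\<^sup>k\<^sup>-\<^sup>1\<close>.\<close>

definition pi_op :: "((nat \<Rightarrow> real) \<Rightarrow> real) \<Rightarrow> (nat \<Rightarrow> real) \<Rightarrow> real" where
  "pi_op f y = (\<integral>t. f (case_nat t y) \<partial>unit_mu)"

primrec Psi :: "nat \<Rightarrow> ((nat \<Rightarrow> real) \<Rightarrow> real) \<Rightarrow> real" where
  "Psi 0 f = 0"
| "Psi (Suc k) f = (\<integral>x. max (f x) 0 \<partial>cube_mu (Suc k)) + Psi k (pi_op f)"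

definition Psi_norm :: "nat \<Rightarrow> ((nat \<Rightarrow> real) \<Rightarrow> real) \<Rightarrow> real" where
  "Psi_norm n f = max (Psi n f) (Psi n (\<lambda>x. - f x))"

end

theory Submission imports Defs begin

text \<open>Peeling off one coordinate at a time gives \<open>\<integral> f g \<le> \<Psi>\<^sub>n(f)\<close> for every
  \<open>g\<close> in \<open>Lip n\<close>. The variation of \<open>g\<close> along the first coordinate is at most 1, so \<open>g\<close> splits as
  \<open>g (t, y) = r (t, y) + h y\<close> with \<open>0 \<le> r \<le> 1\<close> and \<open>h\<close> again Lipschitz, with values in an
  interval that is shorter by 1 (lemma \<open>Lip_split\<close>). The part with \<open>r\<close> contributes at most
  \<open>\<integral> f\<^sub>+\<close>, which is the first summand of \<open>\<Psi>\<close>. By Fubini the part with \<open>h\<close> is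
  \<open>\<integral> (\<pi> f) h\<close>, an instance of the same problem in one dimension less
  (lemma \<open>integral_cons\<close>), and it is bounded by the remaining summands by induction; in
  dimension 0 the range of \<open>g\<close> is \<open>{0}\<close>, so nothing is left over.

  Applying the bound to \<open>-f\<close> as well turns it into one for the absolute value, and passing to the
  supremum over \<open>g\<close> gives the claim.\<close>

section \<open>The cube as a product of an interval and a smaller cube\<close>

lemma space_unit_mu [simp]: "space unit_mu = {0..1}"
  by (simp add: unit_mu_def)

lemma space_cube_mu: "space (cube_mu n) = unit_cube n"
  by (simp add: cube_mu_def unit_cube_def space_PiM)

lemma finite_measure_unit_mu: "finite_measure unit_mu"
  unfolding unit_mu_def by (rule finite_measure_lebesgue_on) simp

lemma sigma_finite_unit_mu: "sigma_finite_measure unit_mu"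
  using finite_measure_unit_mu by (rule finite_measure.axioms)

lemma product_sigma_finite_unit_mu: "product_sigma_finite (\<lambda>_::nat. unit_mu)"
  by (simp add: product_sigma_finite_def sigma_finite_unit_mu)

lemma sigma_finite_cube_mu: "sigma_finite_measure (cube_mu n)"
  unfolding cube_mu_def
  by (rule product_sigma_finite.sigma_finite[OF product_sigma_finite_unit_mu]) simp

lemma pair_sigma_finite_unit_cube: "pair_sigma_finite unit_mu (cube_mu n)"
  by (simp add: pair_sigma_finite_def sigma_finite_unit_mu sigma_finite_cube_mu)

lemma case_nat_in_unit_cube:
  assumes "t \<in> {0..1}" "y \<in> unit_cube n"
  shows "case_nat t y \<in> unit_cube (Suc n)"
  using assms by (auto simp: unit_cube_def PiE_iff extensional_def split: nat.split)

lemma tail_in_unit_cube: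
  assumes "x \<in> unit_cube (Suc n)"
  shows "x 0 \<in> {0..1}" "(\<lambda>i. x (Suc i)) \<in> unit_cube n"
  using assms by (auto simp: unit_cube_def PiE_iff extensional_def)

lemma measurable_case_nat_cube [measurable]:
  "(\<lambda>(t, y). case_nat t y) \<in> unit_mu \<Otimes>\<^sub>M cube_mu n \<rightarrow>\<^sub>M cube_mu (Suc n)"
proof -
  have "(\<lambda>p. case_nat (fst p) (snd p)) \<in> unit_mu \<Otimes>\<^sub>M cube_mu n \<rightarrow>\<^sub>M cube_mu (Suc n)"
    unfolding cube_mu_def
  proof (rule measurable_PiM_single')
    fix i assume "i \<in> {..<Suc n}"
    show "(\<lambda>p. case_nat (fst p) (snd p) i)
        \<in> unit_mu \<Otimes>\<^sub>M (\<Pi>\<^sub>M i\<in>{..<n}. unit_mu) \<rightarrow>\<^sub>M unit_mu"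
    proof (cases i)
      case (Suc j)
      with \<open>i \<in> {..<Suc n}\<close> show ?thesis
        by (simp add: measurable_compose[OF measurable_snd measurable_component_singleton])
    qed simp
  next
    show "(\<lambda>p. case_nat (fst p) (snd p))
        \<in> space (unit_mu \<Otimes>\<^sub>M (\<Pi>\<^sub>M i\<in>{..<n}. unit_mu)) \<rightarrow> (\<Pi>\<^sub>E i\<in>{..<Suc n}. space unit_mu)"
    proof (rule funcsetI)
      fix p assume "p \<in> space (unit_mu \<Otimes>\<^sub>M (\<Pi>\<^sub>M i\<in>{..<n}. unit_mu))"
      then have "fst p \<in> {0..1}" "snd p \<in> unit_cube n"
        by (simp_all add: space_pair_measure space_PiM unit_cube_def mem_Times_iff)
      then show "case_nat (fst p) (snd p) \<in> (\<Pi>\<^sub>E i\<in>{..<Suc n}. space unit_mu)"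
        using case_nat_in_unit_cube[of "fst p" "snd p" n] by (simp only: unit_cube_def space_unit_mu)
    qed
  qed
  then show ?thesis
    by (simp add: case_prod_beta')
qed

text \<open>Prepending a coordinate preserves measure: both sides give a box the product of the
  measures of its sides, and boxes determine a finite product measure.\<close>

lemma distr_case_nat_cube:
  "distr (unit_mu \<Otimes>\<^sub>M cube_mu n) (cube_mu (Suc n)) (\<lambda>(t, y). case_nat t y) = cube_mu (Suc n)"
proof -
  interpret pair_sigma_finite unit_mu "cube_mu n"
    by (rule pair_sigma_finite_unit_cube)
  show ?thesis
    unfolding cube_mu_def[of "Suc n"]
  proof (rule product_sigma_finite.PiM_eqI[OF product_sigma_finite_unit_mu], goal_cases)
    case (3 A)
    have box: "(\<Pi>\<^sub>E i\<in>{..<n}. A (Suc i)) \<in> sets (cube_mu n)"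
      unfolding cube_mu_def using 3 by (intro sets_PiM_I_finite) auto
    have box': "Pi\<^sub>E {..<Suc n} A \<in> sets (cube_mu (Suc n))"
      unfolding cube_mu_def using 3 by (intro sets_PiM_I_finite) auto
    have "(\<lambda>(t, y). case_nat t y) -` Pi\<^sub>E {..<Suc n} A \<inter> space (unit_mu \<Otimes>\<^sub>M cube_mu n)
        = A 0 \<times> (\<Pi>\<^sub>E i\<in>{..<n}. A (Suc i))" (is "?L = ?R")
    proof (intro equalityI subsetI)
      fix p assume "p \<in> ?L"
      then obtain t y where p: "p = (t, y)" and *: "case_nat t y \<in> Pi\<^sub>E {..<Suc n} A"
        and y: "y \<in> unit_cube n"
        by (auto simp: space_pair_measure space_cube_mu)
      have "case_nat t y i \<in> A i" if "i < Suc n" for i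
        using * that by (auto simp: PiE_iff)
      from this[of 0] this[of "Suc i" for i] y show "p \<in> ?R"
        by (auto simp: p PiE_iff unit_cube_def)
    next
      fix p assume "p \<in> ?R"
      then obtain t y where p: "p = (t, y)" and t: "t \<in> A 0" and y: "y \<in> (\<Pi>\<^sub>E i\<in>{..<n}. A (Suc i))"
        by auto
      have sub: "A i \<subseteq> {0..1}" if "i < Suc n" for i
        using 3[of i] that sets.sets_into_space[of "A i" unit_mu] by auto
      have "t \<in> {0..1}"
        using t sub[of 0] by blast
      moreover have "y \<in> unit_cube n"
        unfolding unit_cube_def by (rule subsetD[OF PiE_mono y], rule sub) simp
      moreover have "case_nat t y \<in> Pi\<^sub>E {..<Suc n} A"
        using t y by (auto simp: PiE_iff extensional_def split: nat.split)
      ultimately show "p \<in> ?L"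
        by (auto simp: p space_pair_measure space_cube_mu)
    qed
    then have "emeasure (distr (unit_mu \<Otimes>\<^sub>M cube_mu n) (cube_mu (Suc n)) (\<lambda>(t, y). case_nat t y))
          (Pi\<^sub>E {..<Suc n} A)
        = emeasure (unit_mu \<Otimes>\<^sub>M cube_mu n) (A 0 \<times> (\<Pi>\<^sub>E i\<in>{..<n}. A (Suc i)))"
      using box' by (simp add: emeasure_distr[OF measurable_case_nat_cube])
    also have "\<dots> = emeasure unit_mu (A 0) * emeasure (cube_mu n) (\<Pi>\<^sub>E i\<in>{..<n}. A (Suc i))"
      using 3[of 0] box by (intro M2.emeasure_pair_measure_Times) auto
    also have "emeasure (cube_mu n) (\<Pi>\<^sub>E i\<in>{..<n}. A (Suc i)) = (\<Prod>i<n. emeasure unit_mu (A (Suc i)))"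
      unfolding cube_mu_def using 3
      by (intro product_sigma_finite.emeasure_PiM[OF product_sigma_finite_unit_mu]) auto
    finally show ?case
      by (simp only: prod.lessThan_Suc_shift cube_mu_def)
  qed (auto simp: cube_mu_def)
qed

lemma integrable_cons:
  fixes f :: "(nat \<Rightarrow> real) \<Rightarrow> real"
  assumes "integrable (cube_mu (Suc n)) f"
  shows "integrable (unit_mu \<Otimes>\<^sub>M cube_mu n) (\<lambda>(t, y). f (case_nat t y))"
proof -
  have "integrable (distr (unit_mu \<Otimes>\<^sub>M cube_mu n) (cube_mu (Suc n)) (\<lambda>(t, y). case_nat t y)) f"
    using assms by (simp only: distr_case_nat_cube)
  from integrable_distr[OF measurable_case_nat_cube this] show ?thesis
    by (simp add: case_prod_beta')
qed

lemma integral_cons: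
  fixes f :: "(nat \<Rightarrow> real) \<Rightarrow> real"
  assumes f: "integrable (cube_mu (Suc n)) f"
  shows "(\<integral>x. f x \<partial>cube_mu (Suc n)) = (\<integral>y. pi_op f y \<partial>cube_mu n)"
proof -
  interpret pair_sigma_finite unit_mu "cube_mu n"
    by (rule pair_sigma_finite_unit_cube)
  have "(\<integral>x. f x \<partial>cube_mu (Suc n))
      = (\<integral>x. f x \<partial>distr (unit_mu \<Otimes>\<^sub>M cube_mu n) (cube_mu (Suc n)) (\<lambda>(t, y). case_nat t y))"
    by (simp only: distr_case_nat_cube)
  also have "\<dots> = (\<integral>(t, y). f (case_nat t y) \<partial>(unit_mu \<Otimes>\<^sub>M cube_mu n))"
    using f by (subst integral_distr) (auto simp: case_prod_beta')
  also have "\<dots> = (\<integral>y. pi_op f y \<partial>cube_mu n)"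
    unfolding pi_op_def by (rule integral_snd[OF integrable_cons[OF f], symmetric])
  finally show ?thesis .
qed

lemma integrable_pi_op:
  assumes "integrable (cube_mu (Suc n)) f"
  shows "integrable (cube_mu n) (pi_op f)"
proof -
  interpret pair_sigma_finite unit_mu "cube_mu n"
    by (rule pair_sigma_finite_unit_cube)
  have "integrable (cube_mu n) (\<lambda>y. \<integral>t. f (case_nat t y) \<partial>unit_mu)"
    by (rule integrable_snd[OF integrable_cons[OF assms]])
  then show ?thesis
    by (simp add: pi_op_def[abs_def])
qed

section \<open>Lipschitz functions on the cube\<close>

lemma LipI:
  assumes "\<And>x. x \<in> unit_cube n \<Longrightarrow> 0 \<le> g x \<and> g x \<le> real n"
    and "\<And>x y. x \<in> unit_cube n \<Longrightarrow> y \<in> unit_cube n \<Longrightarrow> \<bar>g x - g y\<bar> \<le> rho n x y"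
  shows "g \<in> Lip n"
  using assms by (auto simp: Lip_def)

lemma Lip_range:
  assumes "g \<in> Lip n" "x \<in> unit_cube n"
  shows "0 \<le> g x" "g x \<le> real n"
  using assms by (auto simp: Lip_def Pi_iff)

lemma Lip_dist:
  assumes "g \<in> Lip n" "x \<in> unit_cube n" "y \<in> unit_cube n"
  shows "\<bar>g x - g y\<bar> \<le> rho n x y"
  using assms by (auto simp: Lip_def)

text \<open>A Lipschitz function is continuous on the cube for the topology of pointwise convergence, and
  the \<open>\<sigma>\<close>-algebra of \<open>cube_mu n\<close> contains the traces of the Borel sets of that topology.\<close>

lemma Lip_measurable:
  assumes g: "g \<in> Lip n"
  shows "g \<in> borel_measurable (cube_mu n)"
proof -
  have "continuous_on (unit_cube n) g"
    unfolding continuous_on_def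
  proof
    fix x assume x: "x \<in> unit_cube n"
    have coord: "((\<lambda>y. y i) \<longlongrightarrow> x i) (at x within unit_cube n)" for i
      using continuous_on_subset[OF continuous_on_product_coordinates[of i] subset_UNIV] x
      unfolding continuous_on_def by blast
    have "((\<lambda>y. rho n y x) \<longlongrightarrow> (\<Sum>i<n. \<bar>x i - x i\<bar>)) (at x within unit_cube n)"
      unfolding rho_def by (intro tendsto_intros coord)
    then have "((\<lambda>y. rho n y x) \<longlongrightarrow> 0) (at x within unit_cube n)"
      by simp
    then have "((\<lambda>y. g y - g x) \<longlongrightarrow> 0) (at x within unit_cube n)"
    proof (rule Lim_null_comparison[rotated])
      show "\<forall>\<^sub>F y in at x within unit_cube n. norm (g y - g x) \<le> rho n y x"
        using Lip_dist[OF g _ x] by (auto simp: eventually_at_filter)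
    qed
    then show "(g \<longlongrightarrow> g x) (at x within unit_cube n)"
      by (rule LIM_zero_cancel)
  qed
  then have g_borel: "g \<in> borel_measurable (restrict_space borel (unit_cube n))"
    by (rule borel_measurable_continuous_on_restrict)
  have "(\<lambda>x. x) \<in> borel_measurable (cube_mu n)"
  proof (rule measurable_coordinatewise_then_product)
    fix i
    show "(\<lambda>x. x i) \<in> borel_measurable (cube_mu n)"
    proof (cases "i < n")
      case True
      have "(\<lambda>t. t) \<in> borel_measurable unit_mu"
        unfolding unit_mu_def
        by (simp add: measurable_completion measurable_restrict_space1)
      then show ?thesis
        unfolding cube_mu_def using True
        by (auto intro: measurable_compose[OF measurable_component_singleton])
    next
      case False
      \<comment> \<open>beyond the dimension, points of the cube have the default value \<open>undefined\<close>\<close>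
      then have "x i = undefined" if "x \<in> space (cube_mu n)" for x
        using that by (auto simp: space_cube_mu unit_cube_def PiE_iff extensional_def)
      then show ?thesis
        by (subst measurable_cong[where g = "\<lambda>_. undefined"]) auto
    qed
  qed
  then have "(\<lambda>x. x) \<in> cube_mu n \<rightarrow>\<^sub>M restrict_space borel (unit_cube n)"
    by (intro measurable_restrict_space2) (auto simp: space_cube_mu)
  from measurable_compose[OF this g_borel] show ?thesis .
qed

lemma integrable_mult_bounded:
  fixes f :: "(nat \<Rightarrow> real) \<Rightarrow> real"
  assumes f: "integrable (cube_mu n) f" and [measurable]: "g \<in> borel_measurable (cube_mu n)"
    and "\<And>x. x \<in> unit_cube n \<Longrightarrow> \<bar>g x\<bar> \<le> B"
  shows "integrable (cube_mu n) (\<lambda>x. f x * g x)"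
proof (rule Bochner_Integration.integrable_bound)
  show "integrable (cube_mu n) (\<lambda>x. B * f x)"
    using f by simp
  show "(\<lambda>x. f x * g x) \<in> borel_measurable (cube_mu n)"
    using f by measurable
  show "AE x in cube_mu n. norm (f x * g x) \<le> norm (B * f x)"
  proof (rule AE_I2)
    fix x assume "x \<in> space (cube_mu n)"
    then have "\<bar>g x\<bar> \<le> \<bar>B\<bar>"
      using assms(3)[of x] by (simp add: space_cube_mu)
    then show "norm (f x * g x) \<le> norm (B * f x)"
      using mult_right_mono[of "\<bar>g x\<bar>" "\<bar>B\<bar>" "\<bar>f x\<bar>"]
      by (simp add: abs_mult mult.commute)
  qed
qed

text \<open>The values \<open>g (t, y)\<close> with \<open>y\<close> fixed lie within \<open>1/2\<close> of the value at the midpoint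
  \<open>t = 1/2\<close>, so \<open>g (1/2, y) - 1/2\<close> is a lower bound that falls short of each of them by at
  most 1, and it is Lipschitz in \<open>y\<close>. Truncating it to \<open>[0, n]\<close> keeps both properties,
  because \<open>g\<close> itself takes values in \<open>[0, n + 1]\<close>.\<close>

lemma Lip_split:
  assumes g: "g \<in> Lip (Suc n)"
  obtains h where "h \<in> Lip n"
    and "\<And>t y. t \<in> {0..1} \<Longrightarrow> y \<in> unit_cube n \<Longrightarrow>
           0 \<le> g (case_nat t y) - h y \<and> g (case_nat t y) - h y \<le> 1"
proof
  define h where "h y = max 0 (min (real n) (g (case_nat (1/2) y) - 1/2))" for y
  have mid: "case_nat (1/2) y \<in> unit_cube (Suc n)" if "y \<in> unit_cube n" for y :: "nat \<Rightarrow> real"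
    using that by (intro case_nat_in_unit_cube) auto
  have rho_case_nat: "rho (Suc n) (case_nat s y) (case_nat t z) = \<bar>s - t\<bar> + rho n y z" for s t y z
    by (simp add: rho_def sum.lessThan_Suc_shift del: sum.lessThan_Suc)
  show "h \<in> Lip n"
  proof (rule LipI)
    fix y z assume "y \<in> unit_cube n" "z \<in> unit_cube n"
    then have "\<bar>g (case_nat (1/2) y) - g (case_nat (1/2) z)\<bar> \<le> rho n y z"
      using Lip_dist[OF g mid mid, of y z] by (simp add: rho_case_nat)
    then show "\<bar>h y - h z\<bar> \<le> rho n y z"
      unfolding h_def by linarith
  qed (auto simp: h_def)
  fix t :: real and y :: "nat \<Rightarrow> real" assume t: "t \<in> {0..1}" and y: "y \<in> unit_cube n"
  have ty: "case_nat t y \<in> unit_cube (Suc n)"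
    using t y by (rule case_nat_in_unit_cube)
  have "\<bar>g (case_nat t y) - g (case_nat (1/2) y)\<bar> \<le> \<bar>t - 1/2\<bar>"
    using Lip_dist[OF g ty mid[OF y]] unfolding rho_case_nat by (simp add: rho_def)
  moreover have "\<bar>t - 1/2\<bar> \<le> 1/2"
    using t by (auto simp: abs_if)
  ultimately show "0 \<le> g (case_nat t y) - h y \<and> g (case_nat t y) - h y \<le> 1"
    using Lip_range[OF g ty] unfolding h_def of_nat_Suc by (intro conjI; linarith)
qed

section \<open>The inequality\<close>

lemma integral_mult_Lip_le_Psi:
  assumes "integrable (cube_mu n) f" "g \<in> Lip n"
  shows "(\<integral>x. f x * g x \<partial>cube_mu n) \<le> Psi n f"
  using assms
proof (induction n arbitrary: f g)
  case 0
  then have "g x = 0" if "x \<in> space (cube_mu 0)" for x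
    using Lip_range[of g 0 x] that by (simp add: space_cube_mu)
  then have "(\<integral>x. f x * g x \<partial>cube_mu 0) = (\<integral>x. 0 \<partial>cube_mu 0)"
    by (intro Bochner_Integration.integral_cong) auto
  then show ?case
    by simp
next
  case (Suc n)
  note f = Suc.prems(1) and g = Suc.prems(2)
  obtain h where h: "h \<in> Lip n"
    and split: "\<And>t y. t \<in> {0..1} \<Longrightarrow> y \<in> unit_cube n \<Longrightarrow>
           0 \<le> g (case_nat t y) - h y \<and> g (case_nat t y) - h y \<le> 1"
    using Lip_split[OF g] by blast
  define H where "H x = h (\<lambda>i. x (Suc i))" for x :: "nat \<Rightarrow> real"
  have remainder: "0 \<le> g x - H x" "g x - H x \<le> 1" if "x \<in> unit_cube (Suc n)" for x
  proof -
    have "case_nat (x 0) (\<lambda>i. x (Suc i)) = x"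
      by (auto split: nat.split)
    then show "0 \<le> g x - H x" "g x - H x \<le> 1"
      using split[OF tail_in_unit_cube[OF that]] by (simp_all add: H_def)
  qed
  have "H \<in> Lip (Suc n)"
  proof (rule LipI)
    fix x z assume "x \<in> unit_cube (Suc n)" "z \<in> unit_cube (Suc n)"
    then have "\<bar>H x - H z\<bar> \<le> rho n (\<lambda>i. x (Suc i)) (\<lambda>i. z (Suc i))"
      unfolding H_def by (intro Lip_dist[OF h] tail_in_unit_cube)
    also have "\<dots> \<le> rho (Suc n) x z"
      by (simp add: rho_def sum.lessThan_Suc_shift del: sum.lessThan_Suc)
    finally show "\<bar>H x - H z\<bar> \<le> rho (Suc n) x z" .
  next
    fix x assume "x \<in> unit_cube (Suc n)"
    from Lip_range[OF h tail_in_unit_cube(2)[OF this]] show "0 \<le> H x \<and> H x \<le> real (Suc n)"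
      by (simp add: H_def)
  qed
  then have [measurable]: "H \<in> borel_measurable (cube_mu (Suc n))"
    by (rule Lip_measurable)
  have [measurable]: "g \<in> borel_measurable (cube_mu (Suc n))"
    using g by (rule Lip_measurable)
  have int_H: "integrable (cube_mu (Suc n)) (\<lambda>x. f x * H x)"
    using Lip_range[OF \<open>H \<in> Lip (Suc n)\<close>]
    by (intro integrable_mult_bounded[OF f, where B = "real (Suc n)"]) auto
  have int_rem: "integrable (cube_mu (Suc n)) (\<lambda>x. f x * (g x - H x))"
    using remainder by (intro integrable_mult_bounded[OF f, where B = 1]) auto
  have "(\<integral>x. f x * g x \<partial>cube_mu (Suc n))
      = (\<integral>x. f x * (g x - H x) + f x * H x \<partial>cube_mu (Suc n))"
    by (simp add: algebra_simps)
  also have "\<dots> = (\<integral>x. f x * (g x - H x) \<partial>cube_mu (Suc n)) + (\<integral>x. f x * H x \<partial>cube_mu (Suc n))"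
    using int_rem int_H by (rule Bochner_Integration.integral_add)
  also have "(\<integral>x. f x * (g x - H x) \<partial>cube_mu (Suc n)) \<le> (\<integral>x. max (f x) 0 \<partial>cube_mu (Suc n))"
  proof (rule integral_mono[OF int_rem])
    show "integrable (cube_mu (Suc n)) (\<lambda>x. max (f x) 0)"
      using f by (intro Bochner_Integration.integrable_max) auto
    fix x assume "x \<in> space (cube_mu (Suc n))"
    then have r: "0 \<le> g x - H x" "g x - H x \<le> 1"
      using remainder by (auto simp: space_cube_mu)
    have "f x * (g x - H x) \<le> max (f x) 0 * (g x - H x)"
      using r by (intro mult_right_mono) auto
    also have "\<dots> \<le> max (f x) 0"
      using r by (intro mult_left_le) auto
    finally show "f x * (g x - H x) \<le> max (f x) 0" .
  qed
  also have "(\<integral>x. f x * H x \<partial>cube_mu (Suc n)) = (\<integral>y. pi_op f y * h y \<partial>cube_mu n)"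
    by (subst integral_cons[OF int_H]) (simp add: pi_op_def[abs_def] H_def)
  also have "\<dots> \<le> Psi n (pi_op f)"
    using integrable_pi_op[OF f] h by (rule Suc.IH)
  finally show ?case
    by simp
qed

theorem theorem8p1:
  fixes n :: nat and f :: "(nat \<Rightarrow> real) \<Rightarrow> real"
  assumes "n \<ge> 1"
    and "integrable (cube_mu n) f"
  shows "Phi_norm n f \<le> Psi_norm n f"
  unfolding Phi_norm_def
proof (rule cSUP_least)
  have "(\<lambda>_. 0) \<in> Lip n"
    by (rule LipI) (auto simp: rho_def sum_nonneg)
  then show "Lip n \<noteq> {}"
    by blast
next
  fix g assume g: "g \<in> Lip n"
  have "(\<integral>x. f x * g x \<partial>cube_mu n) \<le> Psi n f"
    using assms(2) g by (rule integral_mult_Lip_le_Psi)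
  moreover have "- (\<integral>x. f x * g x \<partial>cube_mu n) \<le> Psi n (\<lambda>x. - f x)"
    using integral_mult_Lip_le_Psi[of n "\<lambda>x. - f x" g] assms(2) g by simp
  ultimately show "\<bar>\<integral>x. f x * g x \<partial>cube_mu n\<bar> \<le> Psi_norm n f"
    unfolding Psi_norm_def by linarith
qed

end
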